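(* Let $K$ be the transition matrix of an irreducible aperiodic Markov chain on a finite state space $\mathcal X$ with stationary distribution $\pi$, let $\phi$ be a transition rule for $K$ with driving variable $\mathbf U$, and assume that CFTP based on $\phi$ terminates with probability $1$. Let $T_{\mathrm{CFTP}}$ and $Z_{\mathrm{CFTP}}$ be the running time and the output of CFTP, and let $T_{\mathrm{FMMR}}$ and $Z_{\mathrm{FMMR}}$ be the running time and the initial state of the FMMR algorithm, both algorithms using the same $\phi$. If $T_{\mathrm{CFTP}}$ and $Z_{\mathrm{CFTP}}$ are not independent random variables, then there exist at least one time-window length $t$ and at least one initial state $z\in\mathcal X$ for which $$P(T_{\mathrm{FMMR}}\le t\mid Z_{\mathrm{FMMR}}=z)>P(T_{\mathrm{CFTP}}\le t).$$
   Context: A transition rule for $K$ is a function $\phi:\mathcal X\times\mathcal U\to\mathcal X$ together with a random variable $\mathbf U$ with values in $\mathcal U$ such that $P(\phi(x,\mathbf U)=y)=K(x,y)$ for all $x,y\in\mathcal X$. CFTP (coupling from the past): let $\mathbf U_0,\mathbf U_{-1},\mathbf U_{-2},\dots$ be i.i.d. copies of $\mathbf U$. For $t=0,1,2,\dots$ start a copy of the chain from every state $x$ at time $-t$ and update all copies by $x_s=\phi(x_{s-1},\mathbf U_s)$, $-t+1\le s\le 0$. Trajectories coalesce over the window of length $t$ if all copies agree at time $0$. The running time $T_{\mathrm{CFTP}}$ is the smallest $t$ for which coalescence occurs, and the output $Z_{\mathrm{CFTP}}$ is the common value at time $0$; "terminates with probability $1$" means $T_{\mathrm{CFTP}}<\infty$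 almost surely (and then $Z_{\mathrm{CFTP}}\sim\pi$). FMMR: let $\tilde K$ be the time-reversal of $K$, defined by $\pi(x)K(x,y)=\pi(y)\tilde K(y,x)$. Start in an initial state $\mathbf X_0=Z_{\mathrm{FMMR}}$ and run $\tilde K$ to obtain $\mathbf X_0,\mathbf X_{-1},\mathbf X_{-2},\dots$. Conditionally given the $\mathbf X$-values, generate $\mathbf U_0,\mathbf U_{-1},\dots$ independently, with $\mathbf U_s$ drawn from the conditional distribution of $\mathbf U$ given $\phi(\mathbf X_{s-1},\mathbf U)=\mathbf X_s$. For $t=0,1,\dots$ and $x\in\mathcal X$ set $\mathbf Y^{(-t)}_{-t}(x)=x$ and $\mathbf Y^{(-t)}_s(x)=\phi(\mathbf Y^{(-t)}_{s-1}(x),\mathbf U_s)$ for $-t+1\le s\le 0$. The running time $T_{\mathrm{FMMR}}$ is the smallest $t$ such that the values $\mathbf Y^{(-t)}_0(x)$, $x\in\mathcal X$, all agree (and hence all equal $\mathbf X_0$). Conditioning on $Z_{\mathrm{FMMR}}=z$ means running FMMR from initial state $\mathbf X_0=z$. *)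

theory Defs
  imports "HOL-Probability.Probability" "HOL-Library.Extended_Nat"
begin

definition stochastic_matrix :: "('x::finite \<Rightarrow> 'x \<Rightarrow> real) \<Rightarrow> bool" where
  "stochastic_matrix K \<longleftrightarrow> (\<forall>x y. 0 \<le> K x y) \<and> (\<forall>x. (\<Sum>y\<in>UNIV. K x y) = 1)"

primrec n_step :: "('x::finite \<Rightarrow> 'x \<Rightarrow> real) \<Rightarrow> nat \<Rightarrow> 'x \<Rightarrow> 'x \<Rightarrow> real" where
  "n_step K 0 x y = (if x = y then 1 else 0)"
| "n_step K (Suc n) x y = (\<Sum>z\<in>UNIV. K x z * n_step K n z y)"

definition irreducible_matrix :: "('x::finite \<Rightarrow> 'x \<Rightarrow> real) \<Rightarrow> bool" where
  "irreducible_matrix K \<longleftrightarrow> (\<forall>x y. \<exists>n. 0 < n_step K n x y)"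

definition aperiodic_matrix :: "('x::finite \<Rightarrow> 'x \<Rightarrow> real) \<Rightarrow> bool" where
  "aperiodic_matrix K \<longleftrightarrow> (\<forall>x. Gcd {n. 0 < n \<and> 0 < n_step K n x x} = 1)"

definition stationary_distribution ::
    "('x::finite \<Rightarrow> 'x \<Rightarrow> real) \<Rightarrow> ('x \<Rightarrow> real) \<Rightarrow> bool" where
  "stationary_distribution K \<pi> \<longleftrightarrow>
     (\<forall>x. 0 \<le> \<pi> x) \<and> (\<Sum>x\<in>UNIV. \<pi> x) = 1 \<and> (\<forall>y. (\<Sum>x\<in>UNIV. \<pi> x * K x y) = \<pi> y)"

definition time_reversal ::
    "('x::finite \<Rightarrow> real) \<Rightarrow> ('x \<Rightarrow> 'x \<Rightarrow> real) \<Rightarrow> ('x \<Rightarrow> 'x \<Rightarrow> real) \<Rightarrow> bool" where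
  "time_reversal \<pi> K Kr \<longleftrightarrow> (\<forall>x y. \<pi> x * K x y = \<pi> y * Kr y x)"

(* The driving variable U lives on the probability space P and takes values in the
   measurable space S. *)
definition transition_rule ::
    "'p measure \<Rightarrow> 'u measure \<Rightarrow> ('x::finite \<Rightarrow> 'u \<Rightarrow> 'x) \<Rightarrow> ('p \<Rightarrow> 'u)
      \<Rightarrow> ('x \<Rightarrow> 'x \<Rightarrow> real) \<Rightarrow> bool" where
  "transition_rule P S \<phi> U K \<longleftrightarrow>
     prob_space P \<and> U \<in> P \<rightarrow>\<^sub>M S \<and> (\<forall>x. \<phi> x \<in> S \<rightarrow>\<^sub>M count_space UNIV) \<and>
     (\<forall>x y. \<P>(v in P. \<phi> x (U v) = y) = K x y)"

(* Past times are encoded by natural numbers throughout: the index n stands for time -n.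
   In particular u n is the driver U at time -n, and X n and V n below are the FMMR
   variables X and U at time -n. *)

(* State at time -t + k (for k \<le> t) of the copy started in x at time -t; the update
   leading to time -t + k + 1 uses the driver at that time, i.e. u (t - (k + 1)). *)
primrec trajectory ::
    "('x \<Rightarrow> 'u \<Rightarrow> 'x) \<Rightarrow> (nat \<Rightarrow> 'u) \<Rightarrow> nat \<Rightarrow> 'x \<Rightarrow> nat \<Rightarrow> 'x" where
  "trajectory \<phi> u t x 0 = x"
| "trajectory \<phi> u t x (Suc k) = \<phi> (trajectory \<phi> u t x k) (u (t - Suc k))"

definition coalesces :: "('x \<Rightarrow> 'u \<Rightarrow> 'x) \<Rightarrow> (nat \<Rightarrow> 'u) \<Rightarrow> nat \<Rightarrow> bool" where
  "coalesces \<phi> u t \<longleftrightarrow> (\<exists>y. \<forall>x. trajectory \<phi> u t x t = y)"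

(* The smallest coalescing window length; it is \<infinity> if there is none. *)
definition running_time :: "('x \<Rightarrow> 'u \<Rightarrow> 'x) \<Rightarrow> (nat \<Rightarrow> 'u) \<Rightarrow> enat" where
  "running_time \<phi> u = (INF t \<in> {t. coalesces \<phi> u t}. enat t)"

definition cftp_output :: "('x \<Rightarrow> 'u \<Rightarrow> 'x) \<Rightarrow> (nat \<Rightarrow> 'u) \<Rightarrow> 'x" where
  "cftp_output \<phi> u =
     (case running_time \<phi> u of
        enat t \<Rightarrow> (THE y. \<forall>x. trajectory \<phi> u t x t = y)
      | \<infinity> \<Rightarrow> undefined)"

definition iid_copies ::
    "'p measure \<Rightarrow> 'u measure \<Rightarrow> ('p \<Rightarrow> 'u) \<Rightarrow> 'm measure \<Rightarrow> (nat \<Rightarrow> 'm \<Rightarrow> 'u) \<Rightarrow> bool" where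
  "iid_copies P S U M W \<longleftrightarrow>
     prob_space M \<and> prob_space.indep_vars M (\<lambda>_. S) W UNIV \<and>
     (\<forall>n. distr M S (W n) = distr P S U)"

definition markov_chain_from ::
    "('x::finite \<Rightarrow> 'x \<Rightarrow> real) \<Rightarrow> 'x \<Rightarrow> 'n measure \<Rightarrow> (nat \<Rightarrow> 'n \<Rightarrow> 'x) \<Rightarrow> bool" where
  "markov_chain_from Q z N X \<longleftrightarrow>
     prob_space N \<and> (\<forall>n. X n \<in> N \<rightarrow>\<^sub>M count_space UNIV) \<and>
     (\<forall>n x. \<P>(w in N. \<forall>i\<le>n. X i w = x i) =
        (if x 0 = z then (\<Prod>i<n. Q (x i) (x (Suc i))) else 0))"

definition path_algebra :: "'n measure \<Rightarrow> (nat \<Rightarrow> 'n \<Rightarrow> 'x) \<Rightarrow> 'n measure" where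
  "path_algebra N X =
     vimage_algebra (space N) (\<lambda>w n. X n w) (\<Pi>\<^sub>M n\<in>UNIV. count_space UNIV)"

(* FMMR started in z, on the probability space N.  The last clause says that, conditionally
   on the entire X-path, the V i are independent and V i has the conditional distribution
   of U given \<phi> (X (i + 1)) U = X i.  Almost surely all these conditioning events have
   positive probability, so the convention for null events plays no role. *)
definition fmmr_run ::
    "'p measure \<Rightarrow> 'u measure \<Rightarrow> ('x::finite \<Rightarrow> 'u \<Rightarrow> 'x) \<Rightarrow> ('p \<Rightarrow> 'u)
      \<Rightarrow> ('x \<Rightarrow> 'x \<Rightarrow> real) \<Rightarrow> 'x
      \<Rightarrow> 'n measure \<Rightarrow> (nat \<Rightarrow> 'n \<Rightarrow> 'x) \<Rightarrow> (nat \<Rightarrow> 'n \<Rightarrow> 'u) \<Rightarrow> bool" where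
  "fmmr_run P S \<phi> U Kr z N X V \<longleftrightarrow>
     markov_chain_from Kr z N X \<and> (\<forall>n. V n \<in> N \<rightarrow>\<^sub>M S) \<and>
     (\<forall>I A. finite I \<longrightarrow> (\<forall>i\<in>I. A i \<in> sets S) \<longrightarrow>
        (AE w in N.
           real_cond_exp N (path_algebra N X)
             (indicat_real {w' \<in> space N. \<forall>i\<in>I. V i w' \<in> A i}) w =
           (\<Prod>i\<in>I. \<P>(v in P. U v \<in> A i \<bar> \<phi> (X (Suc i) w) (U v) = X i w))))"

(* The library's indep_var requires both variables to have values in the same type; this is
   its unfolding for two discrete random variables with values in different types. *)
definition indep_discrete :: "'m measure \<Rightarrow> ('m \<Rightarrow> 'a) \<Rightarrow> ('m \<Rightarrow> 'b) \<Rightarrow> bool" where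
  "indep_discrete M S T \<longleftrightarrow>
     S \<in> M \<rightarrow>\<^sub>M count_space UNIV \<and> T \<in> M \<rightarrow>\<^sub>M count_space UNIV \<and>
     prob_space.indep_set M {S -` A \<inter> space M | A. True} {T -` B \<inter> space M | B. True}"

end

theory Submission
  imports Defs
begin

text \<open>Reversing the FMMR path turns it into the stationary forward chain with i.i.d. drivers,
  conditioned to be in z at time 0, and on coalescence the state at time 0 is the CFTP output. Hence
  \<open>\<pi> z * P(T_FMMR \<le> t | z) = P(T_CFTP \<le> t, Z_CFTP = z)\<close>. If no conditional probability on the
  left exceeded \<open>P(T_CFTP \<le> t)\<close>, summation over z would force
  \<open>P(T_CFTP \<le> t, Z_CFTP = z) = \<pi> z * P(T_CFTP \<le> t)\<close> for all t and z, which is independence.\<close>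

section \<open>Coalescence, running time and output for a fixed driver sequence\<close>

text \<open>Window length and common value are kept in one event because the argument compares joint
  events of running time and output; \<open>running_time_le_output_iff\<close> makes the
  link.\<close>

definition coalesces_to :: "('x \<Rightarrow> 'u \<Rightarrow> 'x) \<Rightarrow> (nat \<Rightarrow> 'u) \<Rightarrow> nat \<Rightarrow> 'x \<Rightarrow> bool" where
  "coalesces_to \<phi> u t z \<longleftrightarrow> (\<forall>x. trajectory \<phi> u t x t = z)"

lemma coalesces_iff: "coalesces \<phi> u t \<longleftrightarrow> (\<exists>z. coalesces_to \<phi> u t z)"
  by (simp add: coalesces_def coalesces_to_def)

lemma coalesces_to_unique: "coalesces_to \<phi> u t y \<Longrightarrow> coalesces_to \<phi> u t z \<Longrightarrow> y = z"
  by (auto simp: coalesces_to_def)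

text \<open>The additional driver \<open>u t\<close> acts first, since larger indices lie further in
  the past. For the later updates the indices \<open>Suc t - Suc (Suc k)\<close> and
  \<open>t - Suc k\<close> agree.\<close>

lemma trajectory_shift: "trajectory \<phi> u (Suc t) x (Suc k) = trajectory \<phi> u t (\<phi> x (u t)) k"
  by (induction k) auto

text \<open>Lengthening a window into the past only changes the states from which the old window
  starts, and its final value is the same for every start.\<close>

lemma coalesces_to_mono:
  assumes "coalesces_to \<phi> u s z" "s \<le> t"
  shows "coalesces_to \<phi> u t z"
  \<comment> \<open>The defining equation would peel off the last update; with it deleted,
    \<open>trajectory_shift\<close> peels off the first.\<close>
  using assms(2,1) by (induction rule: dec_induct) (simp_all add: coalesces_to_def trajectory_shift del: trajectory.simps(2))

lemma running_time_le_iff: "running_time \<phi> u \<le> enat t \<longleftrightarrow> coalesces \<phi> u t"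
proof
  assume "running_time \<phi> u \<le> enat t"
  \<comment> \<open>A strict bound on the infimum yields a coalescing window below it.\<close>
  then have "running_time \<phi> u < enat (Suc t)"
    by (metis enat_ord_simps(2) lessI order_le_less_trans)
  then obtain s where "coalesces \<phi> u s" "enat s < enat (Suc t)"
    by (auto simp: running_time_def INF_less_iff)
  then show "coalesces \<phi> u t"
    unfolding coalesces_iff by (metis coalesces_to_mono enat_ord_simps(2) less_Suc_eq_le)
next
  assume "coalesces \<phi> u t"
  then show "running_time \<phi> u \<le> enat t"
    unfolding running_time_def by (intro INF_lower) simp
qed

text \<open>The output is read off at the first coalescing window, and by monotonicity every longer
  window has the same value. The default output for an infinite running time never enters, as the
  bound \<open>enat t\<close> is finite.\<close>

lemma running_time_le_output_iff:
  "running_time \<phi> u \<le> enat t \<and> cftp_output \<phi> u = z \<longleftrightarrow> coalesces_to \<phi> u t z"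
proof -
  have "cftp_output \<phi> u = y" if y: "coalesces_to \<phi> u t y" for y
  proof -
    have "running_time \<phi> u \<le> enat t"
      using y by (auto simp: running_time_le_iff coalesces_iff)
    then obtain s where s: "running_time \<phi> u = enat s" "s \<le> t"
      by (cases "running_time \<phi> u") auto
    then obtain y' where y': "coalesces_to \<phi> u s y'"
      by (metis coalesces_iff order_refl running_time_le_iff)
    then have "y' = y"
      using coalesces_to_unique[OF coalesces_to_mono[OF _ s(2)] y] by simp
    have "(THE v. coalesces_to \<phi> u s v) = y'"
      by (rule the_equality[of "coalesces_to \<phi> u s", OF y' coalesces_to_unique[OF _ y']])
    then show ?thesis
      using s \<open>y' = y\<close> by (simp add: cftp_output_def coalesces_to_def)
  qed
  then show ?thesis
    by (auto simp: running_time_le_iff coalesces_iff)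
qed

text \<open>A window of length \<open>t\<close> reads only the drivers with index below
  \<open>t\<close>. The two driver types may differ, so that drivers can be replaced by the maps
  they induce.\<close>

lemma trajectory_cong_maps:
  assumes "\<And>i x. i < t \<Longrightarrow> \<phi> x (u i) = \<psi> x (v i)" "k \<le> t"
  shows "trajectory \<phi> u t x k = trajectory \<psi> v t x k"
  using assms(2) by (induction k) (simp_all add: assms(1))

lemma coalesces_to_cong_maps:
  assumes "\<And>i x. i < t \<Longrightarrow> \<phi> x (u i) = \<psi> x (v i)"
  shows "coalesces_to \<phi> u t z \<longleftrightarrow> coalesces_to \<psi> v t z"
proof -
  have "trajectory \<phi> u t x t = trajectory \<psi> v t x t" for x
    using assms by (rule trajectory_cong_maps) simp_all
  then show ?thesis
    by (simp add: coalesces_to_def)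
qed

text \<open>Coalescence depends on the drivers only through the update maps \<open>\<lambda>x. \<phi> x u\<close>, of which
  there are finitely many. Using these maps themselves as drivers turns all events into finite unions of
  cylinder events.\<close>

abbreviation (input) map_eval :: "'x \<Rightarrow> ('x \<Rightarrow> 'x) \<Rightarrow> 'x" where
  "map_eval \<equiv> \<lambda>x f. f x"

section \<open>Paths compatible with a sequence of update maps\<close>

text \<open>Indices count backwards in time, so \<open>x t\<close> is the earliest state and the
  maps determine all later ones from it. Extensionality fixes the values beyond \<open>t\<close>,
  which gives equality as functions.\<close>

lemma compatible_path_iff_trajectory:
  assumes "x \<in> extensional {..t}"
  shows "(\<forall>i<t. f i (x (Suc i)) = x i) \<longleftrightarrow>
    x = (\<lambda>i\<in>{..t}. trajectory map_eval f t (x t) (t - i))"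
proof
  assume step: "\<forall>i<t. f i (x (Suc i)) = x i"
  have backward: "x (t - k) = trajectory map_eval f t (x t) k" if "k \<le> t" for k
    using that
  proof (induction k)
    case (Suc k)
    then have "x (t - Suc k) = f (t - Suc k) (x (t - k))"
      using step[rule_format, of "t - Suc k"] by (simp add: Suc_diff_Suc)
    also have "x (t - k) = trajectory map_eval f t (x t) k"
      using Suc by simp
    finally show ?case by simp
  qed simp
  have x: "x i = trajectory map_eval f t (x t) (t - i)" if "i \<le> t" for i
    using backward[of "t - i"] unfolding diff_diff_cancel[OF that] by simp
  show "x = (\<lambda>i\<in>{..t}. trajectory map_eval f t (x t) (t - i))"
  proof (rule extensionalityI[OF assms restrict_extensional])
    fix i assume "i \<in> {..t}"
    then show "x i = (\<lambda>i\<in>{..t}. trajectory map_eval f t (x t) (t - i)) i"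
      using x[of i] by simp
  qed
next
  assume "x = (\<lambda>i\<in>{..t}. trajectory map_eval f t (x t) (t - i))"
  then have restr: "x i = (\<lambda>i\<in>{..t}. trajectory map_eval f t (x t) (t - i)) i" for i
    by (rule fun_cong)
  have x: "x i = trajectory map_eval f t (x t) (t - i)" if "i \<le> t" for i
    using restr[of i] that by simp
  show "\<forall>i<t. f i (x (Suc i)) = x i"
  proof (intro allI impI)
    fix i assume "i < t"
    then have "x i = trajectory map_eval f t (x t) (Suc (t - Suc i))"
      using x[of i] by (simp only: Suc_diff_Suc less_imp_le)
    also have "\<dots> = f i (trajectory map_eval f t (x t) (t - Suc i))"
      using \<open>i < t\<close> by simp
    also have "trajectory map_eval f t (x t) (t - Suc i) = x (Suc i)"
      using x[of "Suc i"] \<open>i < t\<close> by simp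
    finally show "f i (x (Suc i)) = x i" ..
  qed
qed

text \<open>Exactly one compatible path starts from each state, so the earliest state
  \<open>x t\<close> parametrizes the sum.\<close>

lemma sum_compatible_paths:
  fixes g :: "(nat \<Rightarrow> 'x::finite) \<Rightarrow> real"
  shows "(\<Sum>x | x \<in> {..t} \<rightarrow>\<^sub>E UNIV \<and> (\<forall>i<t. f i (x (Suc i)) = x i). g x) =
    (\<Sum>y\<in>UNIV. g (\<lambda>i\<in>{..t}. trajectory map_eval f t y (t - i)))"
proof (rule sum.reindex_bij_witness[where i = "\<lambda>y. \<lambda>i\<in>{..t}. trajectory map_eval f t y (t - i)" and j = "\<lambda>x. x t"])
  fix x assume x: "x \<in> {x. x \<in> {..t} \<rightarrow>\<^sub>E UNIV \<and> (\<forall>i<t. f i (x (Suc i)) = x i)}"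
  then have "x \<in> extensional {..t}" by (auto simp: PiE_def)
  then show "(\<lambda>i\<in>{..t}. trajectory map_eval f t (x t) (t - i)) = x"
    using x by (intro compatible_path_iff_trajectory[of x t f, THEN iffD1, symmetric]) blast+
  then show "g (\<lambda>i\<in>{..t}. trajectory map_eval f t (x t) (t - i)) = g x" by simp
next
  fix y :: 'x
  let ?r = "\<lambda>i\<in>{..t}. trajectory map_eval f t y (t - i)"
  have "?r t = y" by simp
  then have "\<forall>i<t. f i (?r (Suc i)) = ?r i"
    by (subst compatible_path_iff_trajectory[of ?r t f]) (simp_all only: restrict_extensional)
  moreover have "?r \<in> {..t} \<rightarrow>\<^sub>E UNIV" by simp
  ultimately show "?r \<in> {x. x \<in> {..t} \<rightarrow>\<^sub>E UNIV \<and> (\<forall>i<t. f i (x (Suc i)) = x i)}"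
    by (intro CollectI conjI)
qed simp_all

text \<open>Each step trades one reversed transition for a forward one and moves the factor
  \<open>\<pi>\<close> one time unit into the past. Nothing is divided, so zeros of
  \<open>\<pi>\<close> need no separate treatment.\<close>

lemma time_reversal_path:
  assumes "time_reversal \<pi> K Kr"
  shows "\<pi> (x 0) * (\<Prod>i<t. Kr (x i) (x (Suc i))) = \<pi> (x t) * (\<Prod>i<t. K (x (Suc i)) (x i))"
proof (induction t)
  case (Suc t)
  have "\<pi> (x 0) * (\<Prod>i<Suc t. Kr (x i) (x (Suc i))) =
      (\<pi> (x t) * Kr (x t) (x (Suc t))) * (\<Prod>i<t. K (x (Suc i)) (x i))"
    using Suc by simp
  also have "\<pi> (x t) * Kr (x t) (x (Suc t)) = \<pi> (x (Suc t)) * K (x (Suc t)) (x t)"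
    using assms by (simp add: time_reversal_def)
  finally show ?case by simp
qed simp

section \<open>The law of the update map of a single driver\<close>

text \<open>On a finite state space, equality of two maps is a finite conjunction of measurable
  conditions.\<close>

lemma sets_map_event:
  fixes \<phi> :: "'x::finite \<Rightarrow> 'u \<Rightarrow> 'x"
  assumes "\<And>x. \<phi> x \<in> S \<rightarrow>\<^sub>M count_space UNIV"
  shows "{u \<in> space S. (\<lambda>x. \<phi> x u) = f} \<in> sets S"
  using assms unfolding fun_eq_iff by measurable

definition map_prob :: "'p measure \<Rightarrow> ('x \<Rightarrow> 'u \<Rightarrow> 'x) \<Rightarrow> ('p \<Rightarrow> 'u) \<Rightarrow> ('x \<Rightarrow> 'x) \<Rightarrow> real" where
  "map_prob P \<phi> U f = \<P>(v in P. (\<lambda>x. \<phi> x (U v)) = f)"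

text \<open>Valid also for \<open>K x y = 0\<close>, where the conditional probability is the junk value 0.\<close>

lemma kernel_times_cond_map_prob:
  assumes "transition_rule P S \<phi> U K"
  shows "K x y * \<P>(v in P. U v \<in> {u \<in> space S. (\<lambda>x. \<phi> x u) = f} \<bar> \<phi> x (U v) = y) =
    (if f x = y then map_prob P \<phi> U f else 0)"
proof -
  interpret P: prob_space P using assms by (simp add: transition_rule_def)
  have U[measurable]: "U \<in> P \<rightarrow>\<^sub>M S" and \<phi>[measurable]: "\<And>x. \<phi> x \<in> S \<rightarrow>\<^sub>M count_space UNIV"
    and K: "\<P>(v in P. \<phi> x (U v) = y) = K x y"
    using assms by (simp_all add: transition_rule_def)
  let ?E = "{v \<in> space P. U v \<in> {u \<in> space S. (\<lambda>x. \<phi> x u) = f} \<and> \<phi> x (U v) = y}"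
  have E: "P.prob ?E = (if f x = y then map_prob P \<phi> U f else 0)"
  proof (cases "f x = y")
    case True
    then have "?E = {v \<in> space P. (\<lambda>x. \<phi> x (U v)) = f}"
      using measurable_space[OF U] by auto
    then show ?thesis using True by (simp add: map_prob_def)
  next
    case False
    then have "?E = {}" by auto
    then show ?thesis using False by (simp only: measure_empty if_False)
  qed
  \<comment> \<open>If \<open>K x y = 0\<close>, this bound makes the joint event null, so both
    sides vanish.\<close>
  have "P.prob ?E \<le> K x y"
    unfolding K[symmetric] by (intro P.finite_measure_mono) auto
  then show ?thesis
    unfolding cond_prob_def K E[symmetric] by (cases "K x y = 0") (auto intro: antisym)
qed

section \<open>Joint law of the FMMR path and its drivers\<close>

lemma path_algebra_subalgebra:
  assumes "\<And>n. X n \<in> N \<rightarrow>\<^sub>M count_space UNIV"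
  shows "subalgebra N (path_algebra N X)"
proof -
  have "(\<lambda>w n. X n w) \<in> N \<rightarrow>\<^sub>M (\<Pi>\<^sub>M n\<in>UNIV. count_space UNIV)"
    using assms by (intro measurable_PiM_single') auto
  then show ?thesis
    unfolding subalgebra_def path_algebra_def
    by (simp add: measurable_iff_sets)
qed

lemma path_event_in_path_algebra:
  fixes X :: "nat \<Rightarrow> 'n \<Rightarrow> 'x::finite"
  shows "{w \<in> space N. \<forall>i\<le>t. X i w = x i} \<in> sets (path_algebra N X)"
proof -
  let ?H = "\<Pi>\<^sub>M n\<in>(UNIV::nat set). count_space (UNIV::'x set)"
  have "{h \<in> space ?H. \<forall>i\<le>t. h i = x i} \<in> sets ?H"
    by measurable
  then have "(\<lambda>w n. X n w) -` {h \<in> space ?H. \<forall>i\<le>t. h i = x i} \<inter> space N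
      \<in> sets (path_algebra N X)"
    unfolding path_algebra_def by (rule in_vimage_algebra)
  also have "(\<lambda>w n. X n w) -` {h \<in> space ?H. \<forall>i\<le>t. h i = x i} \<inter> space N =
      {w \<in> space N. \<forall>i\<le>t. X i w = x i}"
    by (auto simp: space_PiM)
  finally show ?thesis .
qed

text \<open>This is the averaging property of conditional expectation over \<open>B\<close>, which
  belongs to the subalgebra. It turns conditioning on the whole path into a product formula for
  finite path events.\<close>

lemma (in finite_measure_subalgebra) measure_Int_eq_mult_if_cond_exp_const:
  assumes B: "B \<in> sets F" and [measurable]: "C \<in> sets M"
    and ce: "AE w in M. w \<in> B \<longrightarrow> real_cond_exp M F (indicat_real C) w = c"
  shows "measure M (B \<inter> C) = measure M B * c"
proof -
  have [measurable]: "B \<in> sets M" using B subalg unfolding subalgebra_def by blast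
  have "measure M (B \<inter> C) = (\<integral>w\<in>B. indicat_real C w \<partial>M)"
    unfolding set_lebesgue_integral_def real_scaleR_def indicator_inter_arith[symmetric] by simp
  also have "\<dots> = (\<integral>w\<in>B. real_cond_exp M F (indicat_real C) w \<partial>M)"
    using B by (intro real_cond_exp_intA) (simp_all add: less_top[symmetric])
  also have "\<dots> = (\<integral>w\<in>B. c \<partial>M)"
    unfolding set_lebesgue_integral_def
  proof (rule integral_cong_AE)
    show "AE w in M. indicat_real B w *\<^sub>R real_cond_exp M F (indicat_real C) w = indicat_real B w *\<^sub>R c"
      using ce by eventually_elim (simp add: indicator_def)
  qed measurable
  also have "\<dots> = measure M B * c"
    using set_integral_const[of B M c] by (simp add: emeasure_finite)
  finally show ?thesis .
qed

text \<open>The conditional law of \<open>V i\<close> involves only \<open>X i\<close> and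
  \<open>X (Suc i)\<close>. For \<open>i < t\<close> both are fixed by the states up to index
  \<open>t\<close>, so the conditional probability is constant on the path event.\<close>

lemma fmmr_joint_prob:
  assumes run: "fmmr_run P S \<phi> U Kr z N X V"
    and A: "\<And>i. i < t \<Longrightarrow> A i \<in> sets S"
  shows "\<P>(w in N. (\<forall>i\<le>t. X i w = x i) \<and> (\<forall>i<t. V i w \<in> A i)) =
    (if x 0 = z then \<Prod>i<t. Kr (x i) (x (Suc i)) * \<P>(v in P. U v \<in> A i \<bar> \<phi> (x (Suc i)) (U v) = x i)
     else 0)"
proof -
  interpret prob_space N using run by (simp add: fmmr_run_def markov_chain_from_def)
  have X: "\<And>n. X n \<in> N \<rightarrow>\<^sub>M count_space UNIV" and V[measurable]: "\<And>n. V n \<in> N \<rightarrow>\<^sub>M S"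
    and path: "\<P>(w in N. \<forall>i\<le>t. X i w = x i) =
      (if x 0 = z then (\<Prod>i<t. Kr (x i) (x (Suc i))) else 0)"
    using run by (auto simp: fmmr_run_def markov_chain_from_def)
  have sub: "subalgebra N (path_algebra N X)"
    using X by (rule path_algebra_subalgebra)
  interpret finite_measure_subalgebra N "path_algebra N X"
    by unfold_locales (rule sub)
  define B where "B = {w \<in> space N. \<forall>i\<le>t. X i w = x i}"
  define C where "C = {w \<in> space N. \<forall>i\<in>{..<t}. V i w \<in> A i}"
  let ?c = "\<Prod>i<t. \<P>(v in P. U v \<in> A i \<bar> \<phi> (x (Suc i)) (U v) = x i)"
  have B: "B \<in> sets (path_algebra N X)"
    unfolding B_def by (rule path_event_in_path_algebra)
  then have B'[measurable]: "B \<in> sets N" using sub unfolding subalgebra_def by blast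
  have "{w \<in> space N. V i w \<in> A i} \<in> sets N" if "i < t" for i
    using measurable_sets[OF V A[OF that]] by (simp add: vimage_def Int_def conj_commute)
  then have C[measurable]: "C \<in> sets N"
    unfolding C_def by (intro sets.sets_Collect_finite_All) auto
  have ce: "AE w in N. real_cond_exp N (path_algebra N X) (indicat_real C) w =
      (\<Prod>i<t. \<P>(v in P. U v \<in> A i \<bar> \<phi> (X (Suc i) w) (U v) = X i w))"
    unfolding C_def
    using run[unfolded fmmr_run_def, THEN conjunct2, THEN conjunct2, rule_format, of "{..<t}" A] A
    by simp
  have const: "(\<Prod>i<t. \<P>(v in P. U v \<in> A i \<bar> \<phi> (X (Suc i) w) (U v) = X i w)) = ?c"
    if "w \<in> B" for w
    using that unfolding B_def by (intro prod.cong) auto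
  have "\<P>(w in N. (\<forall>i\<le>t. X i w = x i) \<and> (\<forall>i<t. V i w \<in> A i)) = measure N (B \<inter> C)"
    unfolding B_def C_def by (intro arg_cong[where f = "measure N"]) auto
  also have "\<dots> = measure N B * ?c"
    using B C
  proof (rule measure_Int_eq_mult_if_cond_exp_const)
    show "AE w in N. w \<in> B \<longrightarrow> real_cond_exp N (path_algebra N X) (indicat_real C) w = ?c"
      using ce by eventually_elim (use const in simp)
  qed
  finally show ?thesis
    unfolding path[folded B_def] by (simp add: prod.distrib)
qed

section \<open>Probabilities of update maps under FMMR and under CFTP\<close>

text \<open>The probability is summed over all paths. After time reversal only paths compatible with
  \<open>f\<close> survive, one for each earliest state \<open>y\<close> and with weight
  \<open>\<pi> y\<close> times the product of map probabilities. Coalescence sends all of them to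
  \<open>c\<close>, so either every one ends in \<open>z\<close> or none does.\<close>

lemma fmmr_maps_prob:
  fixes K Kr :: "'x::finite \<Rightarrow> 'x \<Rightarrow> real"
  assumes run: "fmmr_run P S \<phi> U Kr z N X V"
    and rule: "transition_rule P S \<phi> U K"
    and rev: "time_reversal \<pi> K Kr"
    and total: "(\<Sum>x\<in>UNIV. \<pi> x) = 1"
    and f: "coalesces_to map_eval f t c"
  shows "\<pi> z * \<P>(w in N. \<forall>i<t. (\<lambda>y. \<phi> y (V i w)) = f i) =
    (if c = z then \<Prod>i<t. map_prob P \<phi> U (f i) else 0)"
proof -
  interpret prob_space N using run by (simp add: fmmr_run_def markov_chain_from_def)
  have X[measurable]: "\<And>n. X n \<in> N \<rightarrow>\<^sub>M count_space UNIV" and V[measurable]: "\<And>n. V n \<in> N \<rightarrow>\<^sub>M S"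
    using run by (auto simp: fmmr_run_def markov_chain_from_def)
  have \<phi>[measurable]: "\<And>x. \<phi> x \<in> S \<rightarrow>\<^sub>M count_space UNIV"
    using rule by (simp add: transition_rule_def)
  let ?A = "\<lambda>i. {u \<in> space S. (\<lambda>y. \<phi> y u) = f i}"
  let ?Q = "\<Prod>i<t. map_prob P \<phi> U (f i)"
  let ?J = "\<lambda>x w. (\<forall>i\<le>t. X i w = x i) \<and> (\<forall>i<t. V i w \<in> ?A i)"
  have A[measurable]: "?A i \<in> sets S" for i
    using \<phi> by (rule sets_map_event)
  have "\<P>(w in N. \<forall>i<t. (\<lambda>y. \<phi> y (V i w)) = f i) = \<P>(w in N. \<forall>i<t. V i w \<in> ?A i)"
    using measurable_space[OF V] by (intro arg_cong[where f = "measure N"]) auto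
  \<comment> \<open>Each outcome follows exactly one path, its restriction to \<open>{..t}\<close>,
    so the joint events partition.\<close>
  also have "\<dots> = (\<Sum>x\<in>{..t} \<rightarrow>\<^sub>E UNIV. \<P>(w in N. ?J x w))"
  proof (rule prob_sum)
    show "AE w in N. (\<forall>x\<in>{..t} \<rightarrow>\<^sub>E UNIV. ?J x w \<longrightarrow> (\<forall>i<t. V i w \<in> ?A i)) \<and>
        ((\<forall>i<t. V i w \<in> ?A i) \<longrightarrow> (\<exists>!x. x \<in> {..t} \<rightarrow>\<^sub>E UNIV \<and> ?J x w))"
    proof (intro AE_I2 conjI ballI impI)
      fix w assume V: "\<forall>i<t. V i w \<in> ?A i"
      show "\<exists>!x. x \<in> {..t} \<rightarrow>\<^sub>E UNIV \<and> ?J x w"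
      proof (rule ex1I[where a = "\<lambda>i\<in>{..t}. X i w"])
        fix x assume x: "x \<in> {..t} \<rightarrow>\<^sub>E UNIV \<and> ?J x w"
        then show "x = (\<lambda>i\<in>{..t}. X i w)"
          by (intro extensionalityI[of _ "{..t}"]) (auto simp: PiE_def)
      qed (use V in auto)
    qed blast
    show "{w \<in> space N. \<forall>i<t. V i w \<in> ?A i} \<in> events"
      by measurable
    show "{w \<in> space N. ?J x w} \<in> events" for x
      by measurable
  qed (simp add: finite_PiE)
  finally have sum: "\<P>(w in N. \<forall>i<t. (\<lambda>y. \<phi> y (V i w)) = f i) =
      (\<Sum>x\<in>{..t} \<rightarrow>\<^sub>E UNIV. \<P>(w in N. ?J x w))" .
  \<comment> \<open>Reversal replaces \<open>Kr\<close> by \<open>K\<close>, and each factor of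
    \<open>K\<close> combines with its conditional probability into a map probability or zero. The
    remaining weight depends on a compatible path only through \<open>x t\<close>.\<close>
  have joint: "\<pi> z * \<P>(w in N. ?J x w) =
      (if \<forall>i<t. f i (x (Suc i)) = x i then if x 0 = z then \<pi> (x t) * ?Q else 0 else 0)" for x
  proof (cases "x 0 = z")
    case True
    let ?c = "\<lambda>i. \<P>(v in P. U v \<in> ?A i \<bar> \<phi> (x (Suc i)) (U v) = x i)"
    have "\<pi> z * \<P>(w in N. ?J x w) = \<pi> (x 0) * (\<Prod>i<t. Kr (x i) (x (Suc i))) * (\<Prod>i<t. ?c i)"
      using fmmr_joint_prob[OF run, where A = ?A and t = t and x = x, OF A] True
      by (simp only: if_True prod.distrib mult.assoc simp_thms)
    also have "\<dots> = \<pi> (x t) * (\<Prod>i<t. K (x (Suc i)) (x i) * ?c i)"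
      unfolding prod.distrib time_reversal_path[OF rev, of x t] by (simp only: mult.assoc)
    also have "\<dots> = \<pi> (x t) * (\<Prod>i<t. if f i (x (Suc i)) = x i then map_prob P \<phi> U (f i) else 0)"
      by (simp only: kernel_times_cond_map_prob[OF rule])
    also have "(\<Prod>i<t. if f i (x (Suc i)) = x i then map_prob P \<phi> U (f i) else 0) =
        (if \<forall>i<t. f i (x (Suc i)) = x i then ?Q else 0)"
      by (auto simp: prod_zero_iff intro!: prod.cong)
    finally show ?thesis
      unfolding if_P[OF True] if_distrib[where f = "\<lambda>a. \<pi> (x t) * a"] by (simp only: mult_zero_right)
  next
    case False
    then show ?thesis
      using fmmr_joint_prob[OF run, where A = ?A and t = t and x = x, OF A]
      by (simp only: if_False mult_zero_right if_cancel)
  qed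
  have "\<pi> z * \<P>(w in N. \<forall>i<t. (\<lambda>y. \<phi> y (V i w)) = f i) =
      (\<Sum>x | x \<in> {..t} \<rightarrow>\<^sub>E UNIV \<and> (\<forall>i<t. f i (x (Suc i)) = x i). if x 0 = z then \<pi> (x t) * ?Q else 0)"
    unfolding sum sum_distrib_left joint by (subst sum.inter_filter) (simp_all add: finite_PiE)
  \<comment> \<open>The path from \<open>y\<close> has \<open>y\<close> at index \<open>t\<close>
    and, by coalescence, \<open>c\<close> at index 0.\<close>
  also have "\<dots> = (\<Sum>y\<in>UNIV. if c = z then \<pi> y * ?Q else 0)"
    using f unfolding sum_compatible_paths by (intro sum.cong) (simp_all add: coalesces_to_def)
  also have "\<dots> = (if c = z then ?Q else 0)"
    using total by (simp flip: sum_distrib_right)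
  finally show ?thesis .
qed

lemma cftp_maps_prob:
  fixes \<phi> :: "'x::finite \<Rightarrow> 'u \<Rightarrow> 'x"
  assumes iid: "iid_copies P S U M W"
    and rule: "transition_rule P S \<phi> U K"
  shows "\<P>(w in M. \<forall>i<t. (\<lambda>y. \<phi> y (W i w)) = f i) = (\<Prod>i<t. map_prob P \<phi> U (f i))"
proof -
  interpret prob_space M using iid by (simp add: iid_copies_def)
  have indep: "indep_vars (\<lambda>_. S) W UNIV" and distr: "\<And>n. distr M S (W n) = distr P S U"
    using iid by (simp_all add: iid_copies_def)
  then have W: "W n \<in> M \<rightarrow>\<^sub>M S" for n
    by (simp add: indep_vars_def)
  have U: "U \<in> P \<rightarrow>\<^sub>M S" and \<phi>: "\<And>x. \<phi> x \<in> S \<rightarrow>\<^sub>M count_space UNIV"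
    using rule by (simp_all add: transition_rule_def)
  let ?A = "\<lambda>i. {u \<in> space S. (\<lambda>y. \<phi> y u) = f i}"
  have A: "?A i \<in> sets S" for i
    using \<phi> by (rule sets_map_event)
  have "prob (W i -` ?A i \<inter> space M) = measure (distr M S (W i)) (?A i)" for i
    using W A by (simp add: measure_distr)
  also have "measure (distr M S (W i)) (?A i) = measure P (U -` ?A i \<inter> space P)" for i
    using U A by (simp add: distr measure_distr)
  also have "measure P (U -` ?A i \<inter> space P) = map_prob P \<phi> U (f i)" for i
    unfolding map_prob_def using measurable_space[OF U] by (intro arg_cong[where f = "measure P"]) auto
  finally have marginal: "prob (W i -` ?A i \<inter> space M) = map_prob P \<phi> U (f i)" for i .
  show ?thesis
  proof (cases "t = 0")
    case True
    then show ?thesis by (simp add: prob_space)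
  next
    case False
    then have "{w \<in> space M. \<forall>i<t. (\<lambda>y. \<phi> y (W i w)) = f i} = (\<Inter>i\<in>{..<t}. W i -` ?A i \<inter> space M)"
      using measurable_space[OF W] by auto
    also have "prob \<dots> = (\<Prod>i\<in>{..<t}. prob (W i -` ?A i \<inter> space M))"
      using False A by (intro indep_varsD[OF indep]) auto
    finally show ?thesis by (simp only: marginal)
  qed
qed

section \<open>Coalescence events as finite unions over update maps\<close>

lemma coalesces_to_iff_maps:
  "coalesces_to \<phi> u t z \<longleftrightarrow>
    (\<exists>f\<in>{f \<in> {..<t} \<rightarrow>\<^sub>E UNIV. coalesces_to map_eval f t z}. \<forall>i<t. (\<lambda>y. \<phi> y (u i)) = f i)"
proof
  assume "coalesces_to \<phi> u t z"
  moreover have "coalesces_to \<phi> u t z = coalesces_to map_eval (\<lambda>i\<in>{..<t}. \<lambda>y. \<phi> y (u i)) t z"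
    by (rule coalesces_to_cong_maps) simp
  ultimately show "\<exists>f\<in>{f \<in> {..<t} \<rightarrow>\<^sub>E UNIV. coalesces_to map_eval f t z}. \<forall>i<t. (\<lambda>y. \<phi> y (u i)) = f i"
    by (intro bexI[where x = "\<lambda>i\<in>{..<t}. \<lambda>y. \<phi> y (u i)"]) auto
next
  assume "\<exists>f\<in>{f \<in> {..<t} \<rightarrow>\<^sub>E UNIV. coalesces_to map_eval f t z}. \<forall>i<t. (\<lambda>y. \<phi> y (u i)) = f i"
  then obtain f where f: "coalesces_to map_eval f t z" "\<forall>i<t. (\<lambda>y. \<phi> y (u i)) = f i"
    by blast
  have "coalesces_to \<phi> u t z = coalesces_to map_eval f t z"
    using f(2) by (intro coalesces_to_cong_maps) (simp add: fun_eq_iff)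
  then show "coalesces_to \<phi> u t z" using f(1) by simp
qed

lemma pred_maps_eq:
  fixes \<phi> :: "'x::finite \<Rightarrow> 'u \<Rightarrow> 'x" and V :: "nat \<Rightarrow> 'n \<Rightarrow> 'u"
  assumes [measurable]: "\<And>n. V n \<in> N \<rightarrow>\<^sub>M S" "\<And>x. \<phi> x \<in> S \<rightarrow>\<^sub>M count_space UNIV"
  shows "Measurable.pred N (\<lambda>w. \<forall>i<t. (\<lambda>y. \<phi> y (V i w)) = f i)"
proof -
  have [measurable]: "Measurable.pred N (\<lambda>w. (\<lambda>y. \<phi> y (V i w)) = f i)" for i
    unfolding fun_eq_iff by measurable
  show ?thesis by measurable
qed

lemma pred_coalesces_to:
  fixes \<phi> :: "'x::finite \<Rightarrow> 'u \<Rightarrow> 'x"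
  assumes "\<And>n. V n \<in> N \<rightarrow>\<^sub>M S" "\<And>x. \<phi> x \<in> S \<rightarrow>\<^sub>M count_space UNIV"
  shows "Measurable.pred N (\<lambda>w. coalesces_to \<phi> (\<lambda>n. V n w) t z)"
proof -
  have "(\<lambda>w. coalesces_to \<phi> (\<lambda>n. V n w) t z) =
      (\<lambda>w. \<exists>f\<in>{f \<in> {..<t} \<rightarrow>\<^sub>E UNIV. coalesces_to map_eval f t z}. \<forall>i<t. (\<lambda>y. \<phi> y (V i w)) = f i)"
    by (rule ext) (rule coalesces_to_iff_maps)
  then show ?thesis
    by (simp only:) (intro pred_intros_finite pred_maps_eq[OF assms], simp add: finite_PiE)
qed

text \<open>The union is disjoint: the drivers determine the maps on \<open>{..<t}\<close>, and
  extensionality fixes them elsewhere.\<close>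

lemma (in prob_space) prob_coalesces_to:
  fixes \<phi> :: "'x::finite \<Rightarrow> 'u \<Rightarrow> 'x"
  assumes V: "\<And>n. V n \<in> M \<rightarrow>\<^sub>M S" and \<phi>: "\<And>x. \<phi> x \<in> S \<rightarrow>\<^sub>M count_space UNIV"
  shows "\<P>(w in M. coalesces_to \<phi> (\<lambda>n. V n w) t z) =
    (\<Sum>f\<in>{f \<in> {..<t} \<rightarrow>\<^sub>E UNIV. coalesces_to map_eval f t z}. \<P>(w in M. \<forall>i<t. (\<lambda>y. \<phi> y (V i w)) = f i))"
proof (rule prob_sum)
  let ?F = "{f \<in> {..<t} \<rightarrow>\<^sub>E UNIV. coalesces_to map_eval f t z}"
  show "finite ?F" by (simp add: finite_PiE)
  show "{w \<in> space M. coalesces_to \<phi> (\<lambda>n. V n w) t z} \<in> events"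
    by (intro pred_def[THEN iffD1] pred_coalesces_to[OF V \<phi>])
  show "{w \<in> space M. \<forall>i<t. (\<lambda>y. \<phi> y (V i w)) = f i} \<in> events" for f
    by (intro pred_def[THEN iffD1] pred_maps_eq[OF V \<phi>])
  show "AE w in M. (\<forall>f\<in>?F. (\<forall>i<t. (\<lambda>y. \<phi> y (V i w)) = f i) \<longrightarrow> coalesces_to \<phi> (\<lambda>n. V n w) t z) \<and>
      (coalesces_to \<phi> (\<lambda>n. V n w) t z \<longrightarrow> (\<exists>!f. f \<in> ?F \<and> (\<forall>i<t. (\<lambda>y. \<phi> y (V i w)) = f i)))"
  proof (intro AE_I2 conjI ballI impI)
    fix w f assume "f \<in> ?F" "\<forall>i<t. (\<lambda>y. \<phi> y (V i w)) = f i"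
    then show "coalesces_to \<phi> (\<lambda>n. V n w) t z"
      by (intro coalesces_to_iff_maps[THEN iffD2] bexI[of _ f])
  next
    fix w assume "coalesces_to \<phi> (\<lambda>n. V n w) t z"
    then have "\<exists>f\<in>?F. \<forall>i<t. (\<lambda>y. \<phi> y (V i w)) = f i"
      by (rule coalesces_to_iff_maps[THEN iffD1])
    then have ex: "\<exists>f. f \<in> ?F \<and> (\<forall>i<t. (\<lambda>y. \<phi> y (V i w)) = f i)"
      unfolding Bex_def .
    have "f = g" if "f \<in> ?F \<and> (\<forall>i<t. (\<lambda>y. \<phi> y (V i w)) = f i)"
      "g \<in> ?F \<and> (\<forall>i<t. (\<lambda>y. \<phi> y (V i w)) = g i)" for f g
    proof (rule extensionalityI)
      show "f \<in> extensional {..<t}" "g \<in> extensional {..<t}"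
        using that unfolding PiE_def by blast+
    next
      fix i assume "i \<in> {..<t}"
      then have "(\<lambda>y. \<phi> y (V i w)) = f i" "(\<lambda>y. \<phi> y (V i w)) = g i"
        using that by blast+
      then show "f i = g i" by (rule trans[OF sym])
    qed
    then show "\<exists>!f. f \<in> ?F \<and> (\<forall>i<t. (\<lambda>y. \<phi> y (V i w)) = f i)"
      using ex by (rule ex_ex1I[rotated])
  qed
qed

lemma (in prob_space) prob_running_time_le:
  fixes \<phi> :: "'x::finite \<Rightarrow> 'u \<Rightarrow> 'x"
  assumes V: "\<And>n. V n \<in> M \<rightarrow>\<^sub>M S" and \<phi>: "\<And>x. \<phi> x \<in> S \<rightarrow>\<^sub>M count_space UNIV"
  shows "\<P>(w in M. running_time \<phi> (\<lambda>n. V n w) \<le> enat t) =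
    (\<Sum>z\<in>UNIV. \<P>(w in M. coalesces_to \<phi> (\<lambda>n. V n w) t z))"
proof (rule prob_sum)
  have meas[measurable]: "Measurable.pred M (\<lambda>w. coalesces_to \<phi> (\<lambda>n. V n w) t z)" for z
    using V \<phi> by (rule pred_coalesces_to)
  show "{w \<in> space M. running_time \<phi> (\<lambda>n. V n w) \<le> enat t} \<in> events"
    unfolding running_time_le_iff coalesces_iff by measurable
  show "{w \<in> space M. coalesces_to \<phi> (\<lambda>n. V n w) t z} \<in> events" for z
    by measurable
  show "AE w in M. (\<forall>z\<in>UNIV. coalesces_to \<phi> (\<lambda>n. V n w) t z \<longrightarrow> running_time \<phi> (\<lambda>n. V n w) \<le> enat t) \<and>
      (running_time \<phi> (\<lambda>n. V n w) \<le> enat t \<longrightarrow>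
        (\<exists>!z. z \<in> UNIV \<and> coalesces_to \<phi> (\<lambda>n. V n w) t z))"
    unfolding running_time_le_iff coalesces_iff by (auto intro: coalesces_to_unique)
qed simp

text \<open>Both sides expand into sums over map sequences. The FMMR side admits every common value
  \<open>c\<close>, but by \<open>fmmr_maps_prob\<close> only \<open>c = z\<close> contributes, and
  what remains is the CFTP sum.\<close>

lemma fmmr_eq_cftp:
  fixes K Kr :: "'x::finite \<Rightarrow> 'x \<Rightarrow> real"
  assumes run: "fmmr_run P S \<phi> U Kr z N X V"
    and rule: "transition_rule P S \<phi> U K"
    and rev: "time_reversal \<pi> K Kr"
    and total: "(\<Sum>x\<in>UNIV. \<pi> x) = 1"
    and iid: "iid_copies P S U M W"
  shows "\<pi> z * \<P>(w in N. running_time \<phi> (\<lambda>n. V n w) \<le> enat t) =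
    \<P>(w in M. coalesces_to \<phi> (\<lambda>n. W n w) t z)"
proof -
  interpret N: prob_space N using run by (simp add: fmmr_run_def markov_chain_from_def)
  interpret M: prob_space M using iid by (simp add: iid_copies_def)
  have V: "\<And>n. V n \<in> N \<rightarrow>\<^sub>M S" using run by (simp add: fmmr_run_def)
  have W: "\<And>n. W n \<in> M \<rightarrow>\<^sub>M S"
    using iid by (simp add: iid_copies_def M.indep_vars_def)
  have \<phi>: "\<And>x. \<phi> x \<in> S \<rightarrow>\<^sub>M count_space UNIV"
    using rule by (simp add: transition_rule_def)
  let ?F = "\<lambda>c. {f \<in> {..<t} \<rightarrow>\<^sub>E UNIV. coalesces_to map_eval f t c}"
  let ?Q = "\<lambda>f. \<Prod>i<t. map_prob P \<phi> U (f i)"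
  have "\<pi> z * \<P>(w in N. running_time \<phi> (\<lambda>n. V n w) \<le> enat t) =
      (\<Sum>c\<in>UNIV. \<Sum>f\<in>?F c. \<pi> z * \<P>(w in N. \<forall>i<t. (\<lambda>y. \<phi> y (V i w)) = f i))"
    by (simp only: N.prob_running_time_le[OF V \<phi>] N.prob_coalesces_to[OF V \<phi>] sum_distrib_left)
  also have "\<dots> = (\<Sum>c\<in>UNIV. \<Sum>f\<in>?F c. if c = z then ?Q f else 0)"
    using fmmr_maps_prob[OF run rule rev total] by (intro sum.cong refl) blast
  also have "\<dots> = (\<Sum>c\<in>UNIV. if c = z then \<Sum>f\<in>?F c. ?Q f else 0)"
    by (intro sum.cong refl) simp
  also have "\<dots> = (\<Sum>f\<in>?F z. ?Q f)"
    by simp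
  also have "\<dots> = \<P>(w in M. coalesces_to \<phi> (\<lambda>n. W n w) t z)"
    by (simp only: M.prob_coalesces_to[OF W \<phi>] cftp_maps_prob[OF iid rule])
  finally show ?thesis .
qed

section \<open>Measurability and independence of running time and output\<close>

lemma measurable_running_time:
  fixes \<phi> :: "'x::finite \<Rightarrow> 'u \<Rightarrow> 'x"
  assumes V: "\<And>n. V n \<in> N \<rightarrow>\<^sub>M S" and \<phi>: "\<And>x. \<phi> x \<in> S \<rightarrow>\<^sub>M count_space UNIV"
  shows "(\<lambda>w. running_time \<phi> (\<lambda>n. V n w)) \<in> N \<rightarrow>\<^sub>M count_space UNIV"
proof -
  have [measurable]: "Measurable.pred N (\<lambda>w. coalesces \<phi> (\<lambda>n. V n w) t)" for t
    unfolding coalesces_iff by (intro pred_intros_countable pred_coalesces_to[OF V \<phi>])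
  \<comment> \<open>As \<open>enat\<close> is countable, singletons suffice; each is described by
    countably many coalescence events.\<close>
  have T: "running_time \<phi> u = a \<longleftrightarrow>
      (case a of enat n \<Rightarrow> coalesces \<phi> u n \<and> (\<forall>m<n. \<not> coalesces \<phi> u m) | \<infinity> \<Rightarrow> \<forall>n. \<not> coalesces \<phi> u n)" for u a
    unfolding running_time_le_iff[symmetric]
    by (cases a; cases "running_time \<phi> u") (auto simp: not_le intro: antisym leI)
  have "{w \<in> space N. running_time \<phi> (\<lambda>n. V n w) = a} \<in> sets N" for a
    unfolding T by (cases a) simp_all
  then show ?thesis
    by (subst measurable_count_space_eq2_countable) (auto simp: vimage_def Int_def conj_commute)
qed

lemma measurable_cftp_output:
  fixes \<phi> :: "'x::finite \<Rightarrow> 'u \<Rightarrow> 'x"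
  assumes V: "\<And>n. V n \<in> N \<rightarrow>\<^sub>M S" and \<phi>: "\<And>x. \<phi> x \<in> S \<rightarrow>\<^sub>M count_space UNIV"
  shows "(\<lambda>w. cftp_output \<phi> (\<lambda>n. V n w)) \<in> N \<rightarrow>\<^sub>M count_space UNIV"
proof -
  have [measurable]: "Measurable.pred N (\<lambda>w. coalesces_to \<phi> (\<lambda>n. V n w) t z)" for t z
    using V \<phi> by (rule pred_coalesces_to)
  \<comment> \<open>Without coalescence the output is \<open>undefined\<close>, itself some state,
    so that state receives the extra event.\<close>
  have Z: "cftp_output \<phi> u = z \<longleftrightarrow>
      (\<exists>t. coalesces_to \<phi> u t z) \<or> (\<forall>t y. \<not> coalesces_to \<phi> u t y) \<and> undefined = z" for u z
  proof (cases "running_time \<phi> u")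
    case (enat s)
    then show ?thesis
      unfolding running_time_le_output_iff[symmetric] by auto
  next
    case infinity
    then have "cftp_output \<phi> u = undefined" by (simp add: cftp_output_def)
    then show ?thesis
      using infinity unfolding running_time_le_output_iff[symmetric] by auto
  qed
  have "{w \<in> space N. cftp_output \<phi> (\<lambda>n. V n w) = z} \<in> sets N" for z
    unfolding Z by measurable
  then show ?thesis
    by (subst measurable_count_space_eq2_countable) (auto simp: vimage_def Int_def conj_commute countable_finite)
qed

text \<open>Differences carry the factorization from the events \<open>T w \<le> enat t\<close> to
  the atoms of \<open>T\<close>, and countable additivity carries it to arbitrary sets of
  times.\<close>

lemma (in prob_space) indep_discrete_if_cdf_factors:
  fixes T :: "'a \<Rightarrow> enat" and Z :: "'a \<Rightarrow> 'x::finite"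
  assumes T[measurable]: "T \<in> M \<rightarrow>\<^sub>M count_space UNIV" and Z[measurable]: "Z \<in> M \<rightarrow>\<^sub>M count_space UNIV"
    and fin: "AE w in M. T w < \<infinity>"
    and factor: "\<And>t z. \<P>(w in M. T w \<le> enat t \<and> Z w = z) = p z * \<P>(w in M. T w \<le> enat t)"
  shows "indep_discrete M T Z"
proof -
  have cdf: "\<P>(w in M. T w \<le> enat t \<and> Z w \<in> B) = \<P>(w in M. T w \<le> enat t) * sum p B" for t B
  proof -
    have "\<P>(w in M. T w \<le> enat t \<and> Z w \<in> B) = (\<Sum>z\<in>B. \<P>(w in M. T w \<le> enat t \<and> Z w = z))"
      by (rule prob_sum) auto
    then show ?thesis
      by (simp add: factor sum_distrib_right mult.commute)
  qed
  have diff: "\<P>(w in M. T w = enat (Suc n) \<and> Z w \<in> B) =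
      \<P>(w in M. T w \<le> enat (Suc n) \<and> Z w \<in> B) - \<P>(w in M. T w \<le> enat n \<and> Z w \<in> B)" for n B
  proof -
    have split: "a = enat (Suc n) \<longleftrightarrow> a \<le> enat (Suc n) \<and> \<not> a \<le> enat n"
      and mono: "a \<le> enat n \<Longrightarrow> a \<le> enat (Suc n)" for a
      by (cases a; auto)+
    have "{w \<in> space M. T w = enat (Suc n) \<and> Z w \<in> B} =
        {w \<in> space M. T w \<le> enat (Suc n) \<and> Z w \<in> B} - {w \<in> space M. T w \<le> enat n \<and> Z w \<in> B}"
      unfolding split by blast
    also have "prob \<dots> = \<P>(w in M. T w \<le> enat (Suc n) \<and> Z w \<in> B) - \<P>(w in M. T w \<le> enat n \<and> Z w \<in> B)"
    proof (rule finite_measure_Diff)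
      show "{w \<in> space M. T w \<le> enat n \<and> Z w \<in> B} \<subseteq> {w \<in> space M. T w \<le> enat (Suc n) \<and> Z w \<in> B}"
        using mono by blast
    qed measurable
    finally show ?thesis .
  qed
  have atom: "\<P>(w in M. T w = enat n \<and> Z w \<in> B) = \<P>(w in M. T w = enat n) * sum p B" for n B
  proof (cases n)
    case 0
    have "T w = enat 0 \<longleftrightarrow> T w \<le> enat 0" for w by (simp add: zero_enat_def[symmetric])
    then show ?thesis using cdf[of 0 B] 0 by simp
  next
    case (Suc m)
    show ?thesis
      using diff[of m B] diff[of m UNIV] by (simp add: Suc cdf left_diff_distrib)
  qed
  have sums: "(\<lambda>n. if enat n \<in> A then \<P>(w in M. T w = enat n \<and> Z w \<in> B) else 0) sums
      \<P>(w in M. T w \<in> A \<and> Z w \<in> B)" for A B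
  proof -
    let ?E = "\<lambda>n. {w \<in> space M. enat n \<in> A \<and> T w = enat n \<and> Z w \<in> B}"
    have "(\<lambda>n. prob (?E n)) sums prob (\<Union>n. ?E n)"
      by (rule finite_measure_UNION) (auto simp: disjoint_family_on_def)
    \<comment> \<open>The union omits the value infinity of \<open>T\<close>, a null event by
      \<open>fin\<close>.\<close>
    moreover have "prob (\<Union>n. ?E n) = \<P>(w in M. T w \<in> A \<and> Z w \<in> B)"
    proof (rule finite_measure_eq_AE)
      show "AE w in M. w \<in> (\<Union>n. ?E n) \<longleftrightarrow> w \<in> {w \<in> space M. T w \<in> A \<and> Z w \<in> B}"
        using fin by eventually_elim auto
    qed auto
    moreover have "prob (?E n) = (if enat n \<in> A then \<P>(w in M. T w = enat n \<and> Z w \<in> B) else 0)" for n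
      by simp
    ultimately show ?thesis by simp
  qed
  have joint: "\<P>(w in M. T w \<in> A \<and> Z w \<in> B) = \<P>(w in M. T w \<in> A) * sum p B" for A B
  proof -
    have "(\<lambda>n. (if enat n \<in> A then \<P>(w in M. T w = enat n) else 0) * sum p B) sums
        (\<P>(w in M. T w \<in> A) * sum p B)"
      using sums[of A UNIV] by (intro sums_mult2) (simp cong: if_cong)
    moreover have "(if enat n \<in> A then \<P>(w in M. T w = enat n) else 0) * sum p B =
        (if enat n \<in> A then \<P>(w in M. T w = enat n \<and> Z w \<in> B) else 0)" for n
      by (simp add: atom)
    ultimately show ?thesis
      by (intro sums_unique2[OF sums[of A B]]) (simp only:)
  qed
  \<comment> \<open>Taking all times identifies the weights \<open>p\<close> with the law of
    \<open>Z\<close>.\<close>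
  have "\<P>(w in M. Z w \<in> B) = sum p B" for B
    using joint[of UNIV B] by (simp add: prob_space)
  with joint have indep: "\<P>(w in M. T w \<in> A \<and> Z w \<in> B) = \<P>(w in M. T w \<in> A) * \<P>(w in M. Z w \<in> B)" for A B
    by simp
  have "indep_set {T -` A \<inter> space M | A. True} {Z -` B \<inter> space M | B. True}"
  proof (rule indep_setI)
    fix a b assume "a \<in> {T -` A \<inter> space M | A. True}" "b \<in> {Z -` B \<inter> space M | B. True}"
    then obtain A B where ab: "a = T -` A \<inter> space M" "b = Z -` B \<inter> space M" by blast
    have "a \<inter> b = {w \<in> space M. T w \<in> A \<and> Z w \<in> B}" "a = {w \<in> space M. T w \<in> A}"
      "b = {w \<in> space M. Z w \<in> B}"
      unfolding ab by auto
    then show "prob (a \<inter> b) = prob a * prob b"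
      by (simp only: indep)
  qed auto
  then show ?thesis
    using T Z by (simp add: indep_discrete_def)
qed

theorem corollary2p4:
  fixes K Kr :: "'x::finite \<Rightarrow> 'x \<Rightarrow> real"
    and \<pi> :: "'x \<Rightarrow> real"
    and P :: "'p measure"
    and S :: "'u measure"
    and \<phi> :: "'x \<Rightarrow> 'u \<Rightarrow> 'x"
    and U :: "'p \<Rightarrow> 'u"
    and M :: "'m measure"
    and W :: "nat \<Rightarrow> 'm \<Rightarrow> 'u"
    and N :: "'x \<Rightarrow> 'n measure"
    and X :: "'x \<Rightarrow> nat \<Rightarrow> 'n \<Rightarrow> 'x"
    and V :: "'x \<Rightarrow> nat \<Rightarrow> 'n \<Rightarrow> 'u"
    and T_CFTP :: "'m \<Rightarrow> enat"
    and Z_CFTP :: "'m \<Rightarrow> 'x"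
    and T_FMMR :: "'x \<Rightarrow> 'n \<Rightarrow> enat"
  defines "T_CFTP \<equiv> \<lambda>w. running_time \<phi> (\<lambda>n. W n w)"
    and "Z_CFTP \<equiv> \<lambda>w. cftp_output \<phi> (\<lambda>n. W n w)"
    and "T_FMMR \<equiv> \<lambda>z w. running_time \<phi> (\<lambda>n. V z n w)"
  assumes "stochastic_matrix K" "irreducible_matrix K" "aperiodic_matrix K"
    and "stationary_distribution K \<pi>"
    and "time_reversal \<pi> K Kr"
    and "transition_rule P S \<phi> U K"
    and "iid_copies P S U M W"
    and "AE w in M. T_CFTP w < \<infinity>"
    and "\<And>z. fmmr_run P S \<phi> U Kr z (N z) (X z) (V z)"
    and "\<not> indep_discrete M T_CFTP Z_CFTP"
  shows "\<exists>(t::nat) z. \<P>(w in N z. T_FMMR z w \<le> enat t) > \<P>(w in M. T_CFTP w \<le> enat t)"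
proof (rule ccontr)
  assume "\<not> ?thesis"
  then have le: "\<P>(w in N z. T_FMMR z w \<le> enat t) \<le> \<P>(w in M. T_CFTP w \<le> enat t)" for t z
    by (meson not_le)
  note [simp] = T_CFTP_def Z_CFTP_def T_FMMR_def
  interpret prob_space M using assms(10) by (simp add: iid_copies_def)
  have W: "\<And>n. W n \<in> M \<rightarrow>\<^sub>M S"
    using assms(10) by (simp add: iid_copies_def indep_vars_def)
  have \<phi>: "\<And>x. \<phi> x \<in> S \<rightarrow>\<^sub>M count_space UNIV"
    using assms(9) by (simp add: transition_rule_def)
  have \<pi>: "\<And>x. 0 \<le> \<pi> x" "(\<Sum>x\<in>UNIV. \<pi> x) = 1"
    using assms(7) by (simp_all add: stationary_distribution_def)
  let ?a = "\<lambda>t z. \<P>(w in M. coalesces_to \<phi> (\<lambda>n. W n w) t z)"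
  \<comment> \<open>The assumed bound, multiplied by \<open>\<pi> z\<close>, gives an inequality for
    each \<open>z\<close>. Both sides sum over \<open>z\<close> to the probability that CFTP has
    stopped by \<open>t\<close>, so every inequality is an equality.\<close>
  have "?a t z = \<pi> z * \<P>(w in M. T_CFTP w \<le> enat t)" for t z
  proof (rule sum_mono_inv[where f = "?a t" and g = "\<lambda>z. \<pi> z * \<P>(w in M. T_CFTP w \<le> enat t)" and I = UNIV and i = z])
    show "sum (?a t) UNIV = (\<Sum>z\<in>UNIV. \<pi> z * \<P>(w in M. T_CFTP w \<le> enat t))"
      using \<pi>(2) prob_running_time_le[OF W \<phi>, where t = t] by (simp flip: sum_distrib_right)
    show "?a t z \<le> \<pi> z * \<P>(w in M. T_CFTP w \<le> enat t)" for z
      using mult_left_mono[OF le \<pi>(1)]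
      unfolding fmmr_eq_cftp[OF assms(12) assms(9) assms(8) \<pi>(2) assms(10), symmetric] by simp
  qed simp_all
  then have "\<P>(w in M. T_CFTP w \<le> enat t \<and> Z_CFTP w = z) = \<pi> z * \<P>(w in M. T_CFTP w \<le> enat t)" for t z
    unfolding T_CFTP_def Z_CFTP_def running_time_le_output_iff .
  moreover have "T_CFTP \<in> M \<rightarrow>\<^sub>M count_space UNIV"
    unfolding T_CFTP_def using W \<phi> by (rule measurable_running_time)
  moreover have "Z_CFTP \<in> M \<rightarrow>\<^sub>M count_space UNIV"
    unfolding Z_CFTP_def using W \<phi> by (rule measurable_cftp_output)
  ultimately have "indep_discrete M T_CFTP Z_CFTP"
    using assms(11) by (intro indep_discrete_if_cdf_factors)
  then show False using assms(13) by simp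
qed

end
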